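(* Let $\Omega$ be a bounded domain in $\mathbb C^m$, $\mathcal Z$ a complex submanifold of $\Omega$ of codimension $d$, and $f:\Omega\to\mathbb C$ a holomorphic function. Then for each point $p\in\mathcal Z$ and $n\in\mathbb N$ (after rearranging the coordinates of $\mathbb C^m$ so that $\mathcal Z$ has local defining functions $\phi_1,\dots,\phi_d$ at $p$ with $(\partial_j\phi_i(p))_{i,j=1}^d$ invertible) there exists an admissible coordinate chart $(U,\phi)$ of $\Omega$ at $p$ such that $$\partial_\lambda^\alpha(f\circ\phi^{-1})(\lambda)|_{\lambda=\phi(p)}=0\ \text{ for all }0\le|\alpha|\le n\quad\text{if and only if}\quad\partial^\alpha f(z)|_{z=p}=0\ \text{ for all }0\le|\alpha|\le n,$$ where $\alpha=(\alpha_1,\dots,\alpha_d)\in(\mathbb N\cup\{0\})^d$ and $\lambda=(\lambda_1,\dots,\lambda_m)$ denotes the standard coordinates on $\phi(U)\subset\mathbb C^m$.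
   Context: For $\alpha\in(\mathbb N\cup\{0\})^d$, $|\alpha|=\alpha_1+\dots+\alpha_d$, $\partial^\alpha=\frac{\partial^{|\alpha|}}{\partial z_1^{\alpha_1}\cdots\partial z_d^{\alpha_d}}$ and $\partial_\lambda^\alpha=\frac{\partial^{|\alpha|}}{\partial\lambda_1^{\alpha_1}\cdots\partial\lambda_d^{\alpha_d}}$ (derivatives in the first $d$ variables only). An admissible coordinate chart of $\Omega$ at $p\in\mathcal Z$ is a pair $(U,\phi)$ with $U\subset\Omega$ an open neighbourhood of $p$ and $\phi:U\to\phi(U)\subset\mathbb C^m$ a biholomorphism of the form $\phi(z)=(\phi_1(z),\dots,\phi_d(z),z_{d+1}-p_{d+1},\dots,z_m-p_m)$, with $\phi_1,\dots,\phi_d$ holomorphic on $U$, $\phi(p)=0$ and $\phi(U\cap\mathcal Z)=\{\lambda\in\phi(U):\lambda_1=\cdots=\lambda_d=0\}$. *)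

theory Defs
  imports "HOL-Analysis.Analysis" "HOL-Complex_Analysis.Complex_Analysis"
begin

text \<open>
  \<open>\<complex>\<^sup>m\<close> is \<^typ>\<open>complex^'m\<close> with \<open>m = CARD('m)\<close>.  The index type carries no order; an order of the
  coordinates is an enumeration \<open>\<sigma>\<close> of \<^typ>\<open>'m\<close> by \<open>{1..m}\<close>, so that the \<open>i\<close>-th coordinate of \<open>z\<close> is
  \<open>z $ \<sigma> i\<close>.  Rearranging the coordinates amounts to choosing another enumeration.
  Families \<open>g\<^sub>1, \<dots>, g\<^sub>d\<close> and multi-indices \<open>\<alpha>\<close> are functions on \<^typ>\<open>nat\<close> of which only
  the values on \<open>{1..d}\<close> are used.
\<close>

definition coordinate_order :: "(nat \<Rightarrow> 'm::finite) \<Rightarrow> bool" where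
  "coordinate_order \<sigma> \<longleftrightarrow> bij_betw \<sigma> {1..CARD('m)} UNIV"

text \<open>Holomorphy in several variables: Frechet differentiability with complex linear derivative.\<close>

definition holomorphic_scv :: "(complex^'m::finite \<Rightarrow> complex) \<Rightarrow> (complex^'m) set \<Rightarrow> bool" where
  "holomorphic_scv f S \<longleftrightarrow>
    (\<forall>z\<in>S. \<exists>D. (f has_derivative D) (at z) \<and> Vector_Spaces.linear (*s) (*) D)"

definition holomorphic_map :: "(complex^'m::finite \<Rightarrow> complex^'k::finite) \<Rightarrow> (complex^'m) set \<Rightarrow> bool" where
  "holomorphic_map F S \<longleftrightarrow> (\<forall>k. holomorphic_scv (\<lambda>z. F z $ k) S)"

definition biholomorphism_on :: "(complex^'m::finite \<Rightarrow> complex^'m) \<Rightarrow> (complex^'m) set \<Rightarrow> bool" where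
  "biholomorphism_on \<phi> U \<longleftrightarrow>
    open U \<and> open (\<phi> ` U) \<and> inj_on \<phi> U \<and>
    holomorphic_map \<phi> U \<and> holomorphic_map (inv_into U \<phi>) (\<phi> ` U)"

definition partial_deriv :: "'m::finite \<Rightarrow> (complex^'m \<Rightarrow> complex) \<Rightarrow> complex^'m \<Rightarrow> complex" where
  "partial_deriv k f z = deriv (\<lambda>w. f (z + w *s axis k 1)) 0"

text \<open>\<open>\<partial>\<^sup>\<alpha> = \<partial>\<^sub>1\<^bsup>\<alpha> 1\<^esup> \<cdots> \<partial>\<^sub>d\<^bsup>\<alpha> d\<^esup>\<close> in the first \<open>d\<close> coordinates with respect to the order \<open>\<sigma>\<close>.\<close>

definition multi_deriv ::
  "(nat \<Rightarrow> 'm::finite) \<Rightarrow> nat \<Rightarrow> (nat \<Rightarrow> nat) \<Rightarrow> (complex^'m \<Rightarrow> complex) \<Rightarrow> complex^'m \<Rightarrow> complex" where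
  "multi_deriv \<sigma> d \<alpha> f = foldr (\<lambda>i. partial_deriv (\<sigma> i) ^^ \<alpha> i) [1..<Suc d] f"

definition gradient :: "(complex^'m::finite \<Rightarrow> complex) \<Rightarrow> complex^'m \<Rightarrow> complex^'m" where
  "gradient f z = (\<chi> k. partial_deriv k f z)"

text \<open>The last condition says that the Jacobian matrix of \<open>g\<^sub>1, \<dots>, g\<^sub>d\<close> at \<open>p\<close> has (row) rank \<open>d\<close>
  over \<open>\<complex>\<close>.\<close>

definition local_defining_functions ::
  "(complex^'m::finite) set \<Rightarrow> (complex^'m) set \<Rightarrow> nat \<Rightarrow> complex^'m \<Rightarrow>
   (complex^'m) set \<Rightarrow> (nat \<Rightarrow> complex^'m \<Rightarrow> complex) \<Rightarrow> bool" where
  "local_defining_functions \<Omega> Z d p W g \<longleftrightarrow>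
    open W \<and> p \<in> W \<and> W \<subseteq> \<Omega> \<and>
    (\<forall>i\<in>{1..d}. holomorphic_scv (g i) W) \<and>
    Z \<inter> W = {z\<in>W. \<forall>i\<in>{1..d}. g i z = 0} \<and>
    vec.dim ((\<lambda>i. gradient (g i) p) ` {1..d}) = d"

definition complex_submanifold :: "(complex^'m::finite) set \<Rightarrow> (complex^'m) set \<Rightarrow> nat \<Rightarrow> bool" where
  "complex_submanifold \<Omega> Z d \<longleftrightarrow>
    Z \<subseteq> \<Omega> \<and> (\<forall>p\<in>Z. \<exists>W g. local_defining_functions \<Omega> Z d p W g)"

definition invertible_upto :: "nat \<Rightarrow> (nat \<Rightarrow> nat \<Rightarrow> complex) \<Rightarrow> bool" where
  "invertible_upto d A \<longleftrightarrow>
    (\<exists>B. \<forall>i\<in>{1..d}. \<forall>k\<in>{1..d}.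
      (\<Sum>j=1..d. A i j * B j k) = (if i = k then 1 else 0) \<and>
      (\<Sum>j=1..d. B i j * A j k) = (if i = k then 1 else 0))"

definition adapted_order ::
  "(complex^'m::finite) set \<Rightarrow> (complex^'m) set \<Rightarrow> nat \<Rightarrow> complex^'m \<Rightarrow> (nat \<Rightarrow> 'm) \<Rightarrow> bool" where
  "adapted_order \<Omega> Z d p \<sigma> \<longleftrightarrow>
    coordinate_order \<sigma> \<and>
    (\<exists>W g. local_defining_functions \<Omega> Z d p W g \<and>
           invertible_upto d (\<lambda>i j. partial_deriv (\<sigma> j) (g i) p))"

definition admissible_chart ::
  "(complex^'m::finite) set \<Rightarrow> (complex^'m) set \<Rightarrow> nat \<Rightarrow> (nat \<Rightarrow> 'm) \<Rightarrow> complex^'m \<Rightarrow>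
   (complex^'m) set \<Rightarrow> (complex^'m \<Rightarrow> complex^'m) \<Rightarrow> bool" where
  "admissible_chart \<Omega> Z d \<sigma> p U \<phi> \<longleftrightarrow>
    open U \<and> p \<in> U \<and> U \<subseteq> \<Omega> \<and> biholomorphism_on \<phi> U \<and>
    (\<forall>z\<in>U. \<forall>i\<in>{d+1..CARD('m)}. \<phi> z $ \<sigma> i = z $ \<sigma> i - p $ \<sigma> i) \<and>
    \<phi> p = 0 \<and>
    \<phi> ` (U \<inter> Z) = {l \<in> \<phi> ` U. \<forall>i\<in>{1..d}. l $ \<sigma> i = 0}"

end

theory Submission
  imports Defs
begin

text \<open>
  Near \<open>p\<close> the submanifold is a graph. Split the coordinates as \<open>z = (z', z'')\<close>, the first \<open>d\<close> and
  the remaining ones in the given order. Since the Jacobian of the defining functions in \<open>z'\<close> is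
  invertible, the implicit function theorem writes \<open>Z\<close> near \<open>p\<close> as \<open>z' = h(z'')\<close> with \<open>h\<close>
  holomorphic, and the chart is the shear \<open>\<phi>(z) = (z' - h(z''), z'' - p'')\<close>. Its inverse
  \<open>\<lambda> \<mapsto> (\<lambda>' + h(\<lambda>'' + p''), \<lambda>'' + p'')\<close> is a translation on each slice on which \<open>\<lambda>''\<close> is constant;
  on the slice \<open>\<lambda>'' = 0\<close> it is \<open>\<lambda> \<mapsto> \<lambda> + p\<close>, because \<open>h(p'') = p'\<close>. The operators \<open>\<partial>\<^sup>\<alpha>\<close> only see
  the values of a function on such a slice. So for this chart every \<open>\<partial>\<^sup>\<alpha>\<close> of \<open>f \<circ> \<phi>\<^sup>-\<^sup>1\<close> at \<open>0\<close>
  equals the derivative of \<open>f\<close> at \<open>p\<close> with the same multi-index (\<open>multi_deriv_eq_on_slice\<close>).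

  The graph comes from the inverse \<open>H\<close> of \<open>G = (g\<^sub>1, \<dots>, g\<^sub>d, z'' - p'')\<close> near \<open>p\<close>: the point of
  \<open>Z\<close> over \<open>z''\<close> is \<open>H(0, z'' - p'')\<close>. The existence of \<open>H\<close> follows from the inverse function
  theorem for continuously differentiable maps over the reals; holomorphy only asks for
  differentiability at each point, so the continuity of the derivative has to be derived from
  Cauchy's inequality (\<open>continuous_on_partial_deriv\<close>).

  An order of the coordinates for which the Jacobian in \<open>z'\<close> is invertible exists because a matrix
  of row rank \<open>d\<close> has \<open>d\<close> independent columns (\<open>independent_rows_have_independent_columns\<close>).
\<close>

(* The unfolding of 1 to Suc 0 would rewrite the ubiquitous index set {1..d}. *)
declare One_nat_def [simp del]

section \<open>Holomorphic maps and their derivatives\<close>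

lemma norm_smult_axis: "norm (w *s axis k 1 :: complex^'m::finite) = norm w"
proof -
  have "w *s axis k 1 = (axis k w :: complex^'m)"
    by (simp add: vec_eq_iff axis_def)
  then show ?thesis
    by (simp add: norm_eq_sqrt_inner inner_axis_axis)
qed

text \<open>
  A Frechet derivative is additive already, so complex linearity amounts to homogeneity.
\<close>

lemma holomorphic_scv_iff:
  "holomorphic_scv f S \<longleftrightarrow>
    (\<forall>z\<in>S. \<exists>D. (f has_derivative D) (at z) \<and> (\<forall>c v. D (c *s v) = c * D v))"
proof -
  have "Vector_Spaces.linear (*s) (*) D \<longleftrightarrow> (\<forall>c v. D (c *s v) = c * D v)"
    if "(f has_derivative D) (at z)" for D z
  proof -
    have "D (x + y) = D x + D y" for x y
      using that by (simp add: has_derivative_def linear_simps)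
    then show ?thesis
      by (simp add: Vector_Spaces.linear_iff vec.vector_space_axioms
          vector_space_over_itself.vector_space_axioms)
  qed
  then show ?thesis
    unfolding holomorphic_scv_def by blast
qed

lemma holomorphic_map_iff:
  "holomorphic_map F S \<longleftrightarrow>
    (\<forall>z\<in>S. \<exists>D. (F has_derivative D) (at z) \<and> (\<forall>c v. D (c *s v) = c *s D v))"
proof
  assume L: "holomorphic_map F S"
  show "\<forall>z\<in>S. \<exists>D. (F has_derivative D) (at z) \<and> (\<forall>c v. D (c *s v) = c *s D v)"
  proof
    fix z assume z: "z \<in> S"
    from L z have "\<forall>k. \<exists>D. ((\<lambda>z. F z $ k) has_derivative D) (at z) \<and> (\<forall>c v. D (c *s v) = c * D v)"
      unfolding holomorphic_map_def holomorphic_scv_iff by blast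
    then obtain D where D: "\<And>k. ((\<lambda>z. F z $ k) has_derivative D k) (at z)"
        "\<And>k c v. D k (c *s v) = c * D k v"
      by metis
    have "(F has_derivative (\<lambda>v. \<chi> k. D k v)) (at z)"
    proof (subst has_derivative_componentwise_within, intro ballI)
      fix i :: "complex^'b" assume "i \<in> Basis"
      then obtain k b where i: "i = axis k b" by (auto simp: Basis_vec_def)
      show "((\<lambda>x. F x \<bullet> i) has_derivative (\<lambda>x. (\<chi> k. D k x) \<bullet> i)) (at z)"
        using has_derivative_inner_left[OF D(1)[of k], of b] by (simp add: i inner_axis)
    qed
    moreover have "(\<chi> k. D k (c *s v)) = c *s (\<chi> k. D k v)" for c v
      by (simp add: vec_eq_iff D)
    ultimately show "\<exists>D. (F has_derivative D) (at z) \<and> (\<forall>c v. D (c *s v) = c *s D v)"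
      by blast
  qed
next
  assume R: "\<forall>z\<in>S. \<exists>D. (F has_derivative D) (at z) \<and> (\<forall>c v. D (c *s v) = c *s D v)"
  show "holomorphic_map F S"
    unfolding holomorphic_map_def holomorphic_scv_iff
  proof (intro allI ballI)
    fix k z assume "z \<in> S"
    with R obtain D where D: "(F has_derivative D) (at z)" "\<And>c v. D (c *s v) = c *s D v"
      by blast
    have "((\<lambda>z. F z $ k) has_derivative (\<lambda>v. D v $ k)) (at z)"
      by (rule bounded_linear.has_derivative[OF bounded_linear_vec_nth D(1)])
    then show "\<exists>D. ((\<lambda>z. F z $ k) has_derivative D) (at z) \<and> (\<forall>c v. D (c *s v) = c * D v)"
      using D(2) by (intro exI[of _ "\<lambda>v. D v $ k"]) simp
  qed
qed

lemma holomorphic_map_subset: "holomorphic_map F T \<Longrightarrow> S \<subseteq> T \<Longrightarrow> holomorphic_map F S"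
  unfolding holomorphic_map_iff by blast

lemma holomorphic_map_continuous_on: "holomorphic_map F S \<Longrightarrow> continuous_on S F"
  unfolding holomorphic_map_iff
  by (meson has_derivative_at_withinI has_derivative_continuous_on)

lemma holomorphic_map_compose:
  assumes "holomorphic_map F S" "holomorphic_map G T" "\<And>z. z \<in> S \<Longrightarrow> F z \<in> T"
  shows "holomorphic_map (\<lambda>z. G (F z)) S"
  unfolding holomorphic_map_iff
proof
  fix z assume z: "z \<in> S"
  obtain D where D: "(F has_derivative D) (at z)" "\<And>c v. D (c *s v) = c *s D v"
    using assms(1) z unfolding holomorphic_map_iff by blast
  obtain E where E: "(G has_derivative E) (at (F z))" "\<And>c v. E (c *s v) = c *s E v"
    using assms(2) assms(3)[OF z] unfolding holomorphic_map_iff by blast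
  show "\<exists>D. ((\<lambda>z. G (F z)) has_derivative D) (at z) \<and> (\<forall>c v. D (c *s v) = c *s D v)"
    using has_derivative_compose[OF D(1) E(1)] D(2) E(2) by (intro exI[of _ "\<lambda>v. E (D v)"]) simp
qed

lemma holomorphic_map_add:
  assumes "holomorphic_map F S" "holomorphic_map G S"
  shows "holomorphic_map (\<lambda>z. F z + G z) S"
  unfolding holomorphic_map_iff
proof
  fix z assume z: "z \<in> S"
  obtain D where D: "(F has_derivative D) (at z)" "\<And>c v. D (c *s v) = c *s D v"
    using assms(1) z unfolding holomorphic_map_iff by blast
  obtain E where E: "(G has_derivative E) (at z)" "\<And>c v. E (c *s v) = c *s E v"
    using assms(2) z unfolding holomorphic_map_iff by blast
  show "\<exists>D. ((\<lambda>z. F z + G z) has_derivative D) (at z) \<and> (\<forall>c v. D (c *s v) = c *s D v)"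
    using has_derivative_add[OF D(1) E(1)] D(2) E(2)
    by (intro exI[of _ "\<lambda>v. D v + E v"]) (simp add: vector_add_ldistrib)
qed

lemma holomorphic_map_linear_translate:
  assumes "bounded_linear L" "\<And>c v. L (c *s v) = c *s L v"
  shows "holomorphic_map (\<lambda>z. L (z - a)) S"
  unfolding holomorphic_map_iff
proof
  fix z assume z: "z \<in> S"
  have "((\<lambda>z. z - a) has_derivative (\<lambda>v. v)) (at z)"
    by (auto intro!: derivative_eq_intros)
  then have "((\<lambda>z. L (z - a)) has_derivative (\<lambda>v. L v)) (at z)"
    by (rule bounded_linear.has_derivative[OF assms(1)])
  then show "\<exists>D. ((\<lambda>z. L (z - a)) has_derivative D) (at z) \<and> (\<forall>c v. D (c *s v) = c *s D v)"
    using assms(2) by blast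
qed

lemma has_field_derivative_along_line:
  assumes "(f has_derivative D) (at (z + w *s a))" and "\<And>c v. D (c *s v) = c * D v"
  shows "((\<lambda>w. f (z + w *s a)) has_field_derivative D a) (at (w::complex))"
proof -
  have "linear (\<lambda>w::complex. w *s a)"
    by (auto intro!: linearI simp: vec_eq_iff algebra_simps)
  then have "bounded_linear (\<lambda>w::complex. w *s a)"
    by (simp add: linear_conv_bounded_linear)
  then have "((\<lambda>w. z + w *s a) has_derivative (\<lambda>w. w *s a)) (at w)"
    by (auto intro!: derivative_eq_intros bounded_linear_imp_has_derivative)
  from has_derivative_compose[OF this assms(1)] show ?thesis
    by (simp add: has_field_derivative_def assms(2) mult.commute[of _ "D a"])
qed

lemma partial_deriv_eq_derivative_axis:
  assumes "(f has_derivative D) (at z)" and "\<And>c v. D (c *s v) = c * D v"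
  shows "partial_deriv k f z = D (axis k 1)"
  unfolding partial_deriv_def
  using has_field_derivative_along_line[of f D z 0 "axis k 1"] assms by (simp add: DERIV_imp_deriv)

text \<open>
  Partial derivatives are defined by \<^const>\<open>deriv\<close> along coordinate lines; this ties them to the
  Frechet derivative, to which the chain rule and the inverse function theorem apply.
\<close>

lemma derivative_eq_sum_partial_deriv:
  fixes f :: "complex^'m::finite \<Rightarrow> complex"
  assumes "(f has_derivative D) (at z)" and "\<And>c v. D (c *s v) = c * D v"
  shows "D v = (\<Sum>j\<in>UNIV. v $ j * partial_deriv j f z)"
proof -
  have "linear D" using assms(1) by (rule has_derivative_linear)
  have "D v = D (\<Sum>j\<in>UNIV. v $ j *s axis j 1)"
    by (simp add: basis_expansion)
  also have "\<dots> = (\<Sum>j\<in>UNIV. D (v $ j *s axis j 1))"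
    by (rule linear_sum[OF \<open>linear D\<close>])
  finally show ?thesis
    by (simp add: assms(2) partial_deriv_eq_derivative_axis[OF assms])
qed

section \<open>The holomorphic inverse function theorem\<close>

text \<open>
  Cauchy's inequality on a disc of radius \<open>r\<close> in the direction of the \<open>k\<close>-th coordinate bounds the
  difference of the partial derivatives at two points by \<open>1/r\<close> times the largest difference of \<open>f\<close>
  on the two discs, and that is small because \<open>f\<close> is uniformly continuous on compact sets.
\<close>

lemma continuous_on_partial_deriv:
  fixes f :: "complex^'m::finite \<Rightarrow> complex"
  assumes "open S" "holomorphic_scv f S"
  shows "continuous_on S (partial_deriv k f)"
proof -
  have "\<exists>\<delta>>0. \<forall>z. dist z p < \<delta> \<longrightarrow> dist (partial_deriv k f z) (partial_deriv k f p) < e"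
    if "p \<in> S" "e > 0" for p e
  proof -
    obtain s where s: "s > 0" "cball p s \<subseteq> S"
      using \<open>open S\<close> \<open>p \<in> S\<close> open_contains_cball by blast
    \<comment> \<open>Discs of radius \<open>r\<close> around points at distance less than \<open>r\<close> from \<open>p\<close> stay in the ball.\<close>
    define r where "r = s / 2"
    have r: "r > 0" "cball p (2 * r) \<subseteq> S" using s by (auto simp: r_def)
    have "continuous_on S f"
      using assms(2) by (auto simp: holomorphic_scv_iff continuous_on_eq_continuous_at[OF \<open>open S\<close>]
          intro: has_derivative_continuous)
    then have "uniformly_continuous_on (cball p (2 * r)) f"
      using r compact_cball by (intro compact_uniformly_continuous) (auto intro: continuous_on_subset)
    moreover have "e * r / 2 > 0" using r that by simp
    ultimately obtain \<eta> where \<eta>: "\<eta> > 0"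
      "\<And>x y. x \<in> cball p (2 * r) \<Longrightarrow> y \<in> cball p (2 * r) \<Longrightarrow> dist y x < \<eta> \<Longrightarrow> dist (f y) (f x) < e * r / 2"
      unfolding uniformly_continuous_on_def by metis
    have line: "(\<lambda>w. f (x + w *s axis k 1)) field_differentiable (at w)"
      if "x + w *s axis k 1 \<in> S" for x w
      using assms(2) that has_field_derivative_along_line[of f _ x w "axis k 1"]
      unfolding holomorphic_scv_iff field_differentiable_def by blast
    have "dist (partial_deriv k f z) (partial_deriv k f p) < e" if z: "dist z p < min \<eta> r" for z
    proof -
      define h where "h w = f (z + w *s axis k 1) - f (p + w *s axis k 1)" for w
      have in_cball: "z + w *s axis k 1 \<in> cball p (2 * r)" "p + w *s axis k 1 \<in> cball p (2 * r)"
        if "norm w \<le> r" for w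
      proof -
        have "norm (z - p + w *s axis k 1) \<le> norm (z - p) + norm w"
          using norm_triangle_ineq[of "z - p" "w *s axis k 1"] by (simp add: norm_smult_axis)
        moreover have "dist p (z + w *s axis k 1) = norm (z - p + w *s axis k 1)"
          by (subst dist_commute) (simp add: dist_norm algebra_simps)
        ultimately show "z + w *s axis k 1 \<in> cball p (2 * r)"
          using z that by (simp add: dist_norm)
        show "p + w *s axis k 1 \<in> cball p (2 * r)"
          using that r(1) by (simp add: dist_norm norm_smult_axis)
      qed
      have diffs: "(\<lambda>w. f (z + w *s axis k 1)) field_differentiable (at w)"
           "(\<lambda>w. f (p + w *s axis k 1)) field_differentiable (at w)" if "norm w \<le> r" for w
        using in_cball[OF that] r(2) line by blast+
      have hd: "h field_differentiable (at w)" if "norm w \<le> r" for w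
        unfolding h_def using diffs[OF that] by (rule field_differentiable_diff)
      have "h holomorphic_on ball 0 r"
        unfolding holomorphic_on_def
        by (auto intro!: field_differentiable_at_within hd)
      moreover have "continuous_on (cball 0 r) h"
        by (auto intro!: continuous_at_imp_continuous_on field_differentiable_imp_continuous_at hd)
      moreover have "norm (h w) \<le> e * r / 2" if "norm (0 - w) = r" for w
      proof -
        have "dist (z + w *s axis k 1) (p + w *s axis k 1) < \<eta>"
          using z by (simp add: dist_norm)
        then have "dist (f (z + w *s axis k 1)) (f (p + w *s axis k 1)) < e * r / 2"
          using that by (intro \<eta>(2) in_cball) auto
        then show ?thesis by (simp add: h_def dist_norm)
      qed
      ultimately have "norm ((deriv ^^ 1) h 0) \<le> fact 1 * (e * r / 2) / r ^ 1"
        using r(1) by (intro Cauchy_inequality) auto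
      then have "norm (deriv h 0) \<le> e / 2" using r(1) by (simp add: One_nat_def)
      moreover have "deriv h 0 = partial_deriv k f z - partial_deriv k f p"
        unfolding h_def partial_deriv_def using diffs[of 0] r(1) by (intro deriv_diff) auto
      ultimately show ?thesis using \<open>e > 0\<close> by (simp add: dist_norm)
    qed
    then show ?thesis using \<eta>(1) r(1) by (intro exI[of _ "min \<eta> r"]) auto
  qed
  then show ?thesis
    unfolding continuous_on_iff by blast
qed

text \<open>
  The real theorem applies because the derivative depends continuously on the point. Its inverse
  is holomorphic since the inverse of a complex linear bijection is complex linear.
\<close>

lemma holomorphic_inverse_function_theorem:
  fixes G :: "complex^'m::finite \<Rightarrow> complex^'m"
  assumes "open W" "p \<in> W" "holomorphic_map G W"
    and inj: "\<And>v. (\<And>k. (\<Sum>j\<in>UNIV. v $ j * partial_deriv j (\<lambda>z. G z $ k) p) = 0) \<Longrightarrow> v = 0"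
  obtains U V H where "open U" "U \<subseteq> W" "p \<in> U" "open V" "G p \<in> V"
    "homeomorphism U V G H" "holomorphic_map H V"
proof -
  define D where "D z v = (\<chi> k. \<Sum>j\<in>UNIV. v $ j * partial_deriv j (\<lambda>z. G z $ k) z)" for z v
  have lin: "linear (D z)" for z
    unfolding D_def
    by (rule linearI) (auto simp: vec_eq_iff algebra_simps sum.distrib scaleR_sum_right)
  then have bl: "bounded_linear (D z)" for z by (simp add: linear_conv_bounded_linear)
  have hom: "D z (c *s v) = c *s D z v" for z c v
    unfolding D_def by (simp add: vec_eq_iff sum_distrib_left mult.assoc)
  have app: "blinfun_apply (Blinfun (D z)) = D z" for z
    by (rule bounded_linear_Blinfun_apply[OF bl])
  have der: "(G has_derivative blinfun_apply (Blinfun (D z))) (at z)" if "z \<in> W" for z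
  proof -
    obtain E where E: "(G has_derivative E) (at z)" "\<And>c v. E (c *s v) = c *s E v"
      using assms(3) \<open>z \<in> W\<close> unfolding holomorphic_map_iff by blast
    have "E v $ k = D z v $ k" for v k
      using derivative_eq_sum_partial_deriv[of "\<lambda>z. G z $ k" "\<lambda>v. E v $ k" z v]
        bounded_linear.has_derivative[OF bounded_linear_vec_nth E(1)] E(2)
      by (simp add: D_def)
    then have "E = D z" by (auto simp: vec_eq_iff)
    with E show ?thesis by (simp add: app)
  qed
  have cont: "continuous_on W (\<lambda>z. Blinfun (D z))"
  proof (rule continuous_on_blinfun_componentwise)
    fix i :: "complex^'m"
    show "continuous_on W (\<lambda>z. blinfun_apply (Blinfun (D z)) i)"
      unfolding app D_def using assms(1,3) unfolding holomorphic_map_def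
      by (intro continuous_on_vec_lambda continuous_intros continuous_on_partial_deriv) auto
  qed
  have "inj (D p)"
    unfolding linear_injective_0[OF lin]
  proof (intro allI impI)
    fix v assume "D p v = 0"
    then show "v = 0" by (intro inj) (simp add: D_def vec_eq_iff)
  qed
  then obtain E where E: "linear E" "E \<circ> D p = id"
    using linear_injective_left_inverse[OF lin] by blast
  have blE: "bounded_linear E" using E(1) by (simp add: linear_conv_bounded_linear)
  have "Blinfun E o\<^sub>L Blinfun (D p) = id_blinfun"
    using fun_cong[OF E(2)]
    by (intro blinfun_eqI) (simp add: app bounded_linear_Blinfun_apply[OF blE])
  from inverse_function_theorem[OF \<open>open W\<close> der cont \<open>p \<in> W\<close> this]
  obtain U V H H' where UVH: "open U" "U \<subseteq> W" "p \<in> U" "open V" "G p \<in> V"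
    "homeomorphism U V G H"
    and H': "\<And>y. y \<in> V \<Longrightarrow> (H has_derivative H' y) (at y)"
    "\<And>y. y \<in> V \<Longrightarrow> H' y = inv (D (H y))"
    "\<And>y. y \<in> V \<Longrightarrow> bij (D (H y))"
    unfolding app by metis
  have "H' y (c *s v) = c *s H' y v" if "y \<in> V" for y c v
  proof -
    let ?T = "D (H y)"
    note b = H'(3)[OF that]
    have "?T (c *s inv ?T v) = c *s v"
      using b by (simp add: hom bij_is_surj surj_f_inv_f)
    then show ?thesis
      unfolding H'(2)[OF that] using b by (metis bij_inv_eq_iff)
  qed
  then have "holomorphic_map H V"
    unfolding holomorphic_map_iff using H'(1) by blast
  with UVH that show ?thesis by blast
qed

section \<open>An order of the coordinates adapted to the submanifold\<close>

text \<open>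
  Extend the rows to a basis by unit vectors (Steinitz) and let \<open>J\<close> be the set of the indices
  whose unit vectors were not added. A combination of the rows that vanishes on \<open>J\<close> is a
  combination of the added unit vectors, so its coefficients vanish. Writing the unit vectors of
  \<open>J\<close> in this basis and forgetting the components outside \<open>J\<close> gives a left inverse \<open>C\<close> of the
  square submatrix with columns in \<open>J\<close>. The last two conclusions together make this
  submatrix invertible.
\<close>

lemma independent_rows_have_independent_columns:
  fixes r :: "nat \<Rightarrow> ('a::field)^'m::finite"
  assumes "vec.dim (r ` {1..d}) = d"
  obtains J C where "card J = d"
    "\<forall>c. (\<forall>k\<in>J. (\<Sum>i=1..d. c i * r i $ k) = 0) \<longrightarrow> (\<forall>i\<in>{1..d}. c i = 0)"
    "\<forall>k\<in>J. \<forall>l\<in>J. (\<Sum>i=1..d. C k i * r i $ l) = (if k = l then 1 else 0)"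
proof -
  let ?R = "r ` {1..d}"
  have "d \<le> card ?R"
    using vec.dim_le_card[of ?R ?R] vec.span_superset[of ?R] assms by simp
  then have card_R: "card ?R = d"
    using card_image_le[of "{1..d}" r] by simp
  then have inj_r: "inj_on r {1..d}"
    by (intro eq_card_imp_inj_on) simp_all
  have ind_R: "vec.independent ?R"
    using vec.card_le_dim_spanning[of ?R ?R] assms card_R vec.span_superset[of ?R] by simp
  obtain B where B: "?R \<subseteq> B" "B \<subseteq> ?R \<union> cart_basis" "vec.independent B" "?R \<union> cart_basis \<subseteq> vec.span B"
    using vec.maximal_independent_subset_extend[of ?R "?R \<union> cart_basis"] ind_R by blast
  have span_B: "vec.span B = UNIV"
    using vec.span_mono[of cart_basis "vec.span B"] B(4) by (auto simp: vec.span_span)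
  have fin_B: "finite B" using B(3) vec.finiteI_independent by blast
  have "card B = CARD('m)"
    using vec.dim_eq_card[OF _ B(3), of UNIV] span_B by (simp add: card_cart_basis vec.dim_UNIV)
  define J where "J = {k. axis k 1 \<notin> B - ?R}"
  have E: "B - ?R = (\<lambda>k. axis k 1) ` (- J)"
    using B(2) by (auto simp: J_def cart_basis_def)
  have inj_axis: "inj_on (\<lambda>k. axis k 1 :: 'a^'m) A" for A
    by (auto simp: inj_on_def axis_eq_axis)
  have "card (- J) = CARD('m) - d"
    using card_image[OF inj_axis[of "- J"]] card_Diff_subset[of ?R B] B(1) \<open>card B = CARD('m)\<close> card_R
    by (simp add: E)
  moreover have "d \<le> CARD('m)"
    using card_mono[OF fin_B B(1)] card_R \<open>card B = CARD('m)\<close> by simp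
  moreover have "card J \<le> CARD('m)" by (intro card_mono) auto
  ultimately have card_J: "card J = d"
    using card_Diff_subset[of J UNIV] by (simp add: Compl_eq_Diff_UNIV)
  have ind_J: "\<forall>c. (\<forall>k\<in>J. (\<Sum>i=1..d. c i * r i $ k) = 0) \<longrightarrow> (\<forall>i\<in>{1..d}. c i = 0)"
  proof (intro allI impI)
    fix c assume c: "\<forall>k\<in>J. (\<Sum>i=1..d. c i * r i $ k) = 0"
    define x where "x = (\<Sum>i=1..d. c i *s r i)"
    \<comment> \<open>The coefficients of the relation \<open>x - x = 0\<close> between basis vectors, where
      the first \<open>x\<close> is written in the rows and the second one in the added unit vectors.\<close>
    define u where "u v = (if v \<in> ?R then c (the_inv_into {1..d} r v) else - (x $ (THE k. v = axis k 1)))" for v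
    have "(\<Sum>v\<in>?R. u v *s v) = (\<Sum>i=1..d. c i *s r i)"
      by (subst sum.reindex[OF inj_r]) (auto simp: u_def the_inv_into_f_f[OF inj_r] intro!: sum.cong)
    then have sum_R: "(\<Sum>v\<in>?R. u v *s v) = x"
      by (simp add: x_def)
    have u_axis: "u (axis k 1) = - x $ k" if "k \<in> - J" for k
    proof -
      have "axis k 1 \<in> B - ?R" using that E by blast
      moreover have "(THE j. axis k (1::'a) = axis j 1) = k"
        by (rule the_equality) (auto simp: axis_eq_axis)
      ultimately show ?thesis by (simp add: u_def)
    qed
    have "(\<Sum>v\<in>B - ?R. u v *s v) = (\<Sum>k\<in>- J. (- x $ k) *s axis k 1)"
      unfolding E by (subst sum.reindex[OF inj_axis]) (auto simp: u_axis intro!: sum.cong)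
    also have "\<dots> = - (\<Sum>k\<in>- J. x $ k *s axis k 1)"
      by (simp add: sum_negf)
    also have "(\<Sum>k\<in>- J. x $ k *s axis k 1) = (\<Sum>k\<in>UNIV. x $ k *s axis k 1)"
      using c by (intro sum.mono_neutral_left) (auto simp: x_def sum_component)
    also have "\<dots> = x" by (rule basis_expansion)
    finally have "(\<Sum>v\<in>B. u v *s v) = 0"
      using sum.subset_diff[OF B(1) fin_B, of "\<lambda>v. u v *s v"] sum_R by simp
    then have "u (r i) = 0" if "i \<in> {1..d}" for i
      using vec.independentD[OF B(3) fin_B subset_refl, of u "r i"] B(1) that by blast
    then show "\<forall>i\<in>{1..d}. c i = 0" by (simp add: u_def the_inv_into_f_f[OF inj_r])
  qed
  have "\<exists>C. \<forall>l\<in>J. (\<Sum>i=1..d. C i * r i $ l) = (if k = l then 1 else 0)" for k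
  proof -
    have "axis k 1 \<in> vec.span (?R \<union> (B - ?R))"
      using span_B B(1) by (simp add: Un_absorb1)
    then obtain x y where xy: "axis k 1 = x + y" "x \<in> vec.span ?R" "y \<in> vec.span (B - ?R)"
      unfolding vec.span_Un by blast
    obtain u where u: "x = (\<Sum>v\<in>?R. u v *s v)"
      using xy(2) vec.span_finite[of ?R] by auto
    have "vec.span (B - ?R) \<subseteq> {v. \<forall>l\<in>J. v $ l = 0}"
      by (rule vec.span_minimal) (auto simp: E vec.subspace_def axis_def)
    then have "y $ l = 0" if "l \<in> J" for l using xy(3) that by blast
    moreover have "x = (\<Sum>i=1..d. u (r i) *s r i)"
      unfolding u by (subst sum.reindex[OF inj_r]) simp
    ultimately have "(\<Sum>i=1..d. u (r i) * r i $ l) = (axis k 1 :: 'a^'m) $ l" if "l \<in> J" for l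
      unfolding xy(1) using that by (simp add: sum_component)
    then show ?thesis by (intro exI[of _ "\<lambda>i. u (r i)"]) (auto simp: axis_def)
  qed
  then have "\<exists>C. \<forall>k. \<forall>l\<in>J. (\<Sum>i=1..d. C k i * r i $ l) = (if k = l then 1 else 0)"
    by (intro choice allI)
  then obtain C where C: "\<forall>k. \<forall>l\<in>J. (\<Sum>i=1..d. C k i * r i $ l) = (if k = l then 1 else 0)"
    by (rule exE)
  show ?thesis
    using C by (intro that[OF card_J ind_J, of C]) simp
qed

lemma exists_adapted_order:
  assumes "local_defining_functions \<Omega> Z d p W g"
  shows "\<exists>\<sigma>. adapted_order \<Omega> Z d p \<sigma>"
proof -
  let ?r = "\<lambda>i. gradient (g i) p"
  have dim: "vec.dim (?r ` {1..d}) = d"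
    using assms by (simp add: local_defining_functions_def)
  obtain J C where J: "card J = d"
    and ind: "\<forall>c. (\<forall>k\<in>J. (\<Sum>i=1..d. c i * ?r i $ k) = 0) \<longrightarrow> (\<forall>i\<in>{1..d}. c i = 0)"
    and C: "\<forall>k\<in>J. \<forall>l\<in>J. (\<Sum>i=1..d. C k i * ?r i $ l) = (if k = l then 1 else 0)"
    by (rule independent_rows_have_independent_columns[OF dim])
  have d: "d \<le> CARD('a)" using J card_mono[of "UNIV :: 'a set" J] by simp
  obtain \<tau> where \<tau>: "bij_betw \<tau> {1..d} J"
    using finite_same_card_bij[of "{1..d}" J] J by auto
  obtain \<rho> where \<rho>: "bij_betw \<rho> {d+1..CARD('a)} (- J)"
    using finite_same_card_bij[of "{d+1..CARD('a)}" "- J"] J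
    by (auto simp: card_Diff_subset Compl_eq_Diff_UNIV)
  define \<sigma> where "\<sigma> i = (if i \<in> {1..d} then \<tau> i else \<rho> i)" for i
  have \<sigma>: "bij_betw \<sigma> {1..d} J"
    using \<tau> by (rule bij_betw_cong[THEN iffD1, rotated]) (simp add: \<sigma>_def)
  have "bij_betw \<sigma> {d+1..CARD('a)} (- J)"
    using \<rho> by (rule bij_betw_cong[THEN iffD1, rotated]) (simp add: \<sigma>_def)
  moreover have "{1..d} \<union> {d+1..CARD('a)} = {1..CARD('a)}" using d by auto
  ultimately have "coordinate_order \<sigma>"
    unfolding coordinate_order_def using bij_betw_combine[OF \<sigma>] by force
  moreover have "invertible_upto d (\<lambda>i j. partial_deriv (\<sigma> j) (g i) p)"
    unfolding invertible_upto_def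
  proof (intro exI ballI conjI)
    fix i k assume i: "i \<in> {1..d}" and k: "k \<in> {1..d}"
    let ?A = "\<lambda>i j. partial_deriv (\<sigma> j) (g i) p"
    have \<sigma>_eq: "\<sigma> a = \<sigma> b \<longleftrightarrow> a = b" if "a \<in> {1..d}" "b \<in> {1..d}" for a b
      using \<sigma> that by (meson bij_betw_imp_inj_on inj_on_eq_iff)
    have left_inverse: "(\<Sum>j=1..d. C (\<sigma> a) j * ?A j b) = (if a = b then 1 else 0)"
      if "a \<in> {1..d}" "b \<in> {1..d}" for a b
      using C[rule_format, of "\<sigma> a" "\<sigma> b"] \<sigma> that \<sigma>_eq by (simp add: gradient_def bij_betw_apply)
    then show "(\<Sum>j=1..d. C (\<sigma> i) j * ?A j k) = (if i = k then 1 else 0)"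
      using i k by blast
    \<comment> \<open>The \<open>i\<close>-th row of \<open>A C - I\<close>: it is killed by \<open>A\<close> because \<open>C A = I\<close>, hence it
      is zero by the independence of the rows of \<open>A\<close>.\<close>
    define c where "c b = (\<Sum>j=1..d. ?A i j * C (\<sigma> j) b) - (if i = b then 1 else 0)" for b
    have "(\<Sum>b=1..d. c b * ?r b $ l) = 0" if "l \<in> J" for l
    proof -
      obtain a where a: "a \<in> {1..d}" "l = \<sigma> a"
        using \<sigma> \<open>l \<in> J\<close> by (auto simp: bij_betw_def)
      have "(\<Sum>b=1..d. c b * ?r b $ l) = (\<Sum>b=1..d. (\<Sum>j=1..d. ?A i j * C (\<sigma> j) b) * ?A b a)
          - (\<Sum>b=1..d. (if i = b then 1 else 0) * ?A b a)"
        by (simp add: c_def gradient_def a(2) left_diff_distrib sum_subtractf)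
      also have "(\<Sum>b=1..d. (if i = b then 1 else 0) * ?A b a) = ?A i a"
        using i by (simp add: if_distrib[of "\<lambda>x. x * _"] sum.delta cong: if_cong)
      also have "(\<Sum>b=1..d. (\<Sum>j=1..d. ?A i j * C (\<sigma> j) b) * ?A b a)
          = (\<Sum>j=1..d. ?A i j * (\<Sum>b=1..d. C (\<sigma> j) b * ?A b a))"
        unfolding sum_distrib_right sum_distrib_left
        by (subst sum.swap) (simp add: mult.assoc)
      also have "\<dots> = (\<Sum>j=1..d. ?A i j * (if j = a then 1 else 0))"
        using left_inverse a(1) by (intro sum.cong) auto
      also have "\<dots> = ?A i a"
        using a(1) by (simp add: if_distrib[of "\<lambda>x. _ * x"] sum.delta cong: if_cong)
      finally show ?thesis by simp
    qed
    then have "c k = 0" using ind k by blast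
    then show "(\<Sum>j=1..d. ?A i j * C (\<sigma> j) k) = (if i = k then 1 else 0)"
      by (simp add: c_def)
  qed
  ultimately show ?thesis
    using assms unfolding adapted_order_def by blast
qed

section \<open>Shear charts\<close>

definition drop_coords :: "'m set \<Rightarrow> complex^'m::finite \<Rightarrow> complex^'m" where
  "drop_coords J z = (\<chi> k. if k \<in> J then 0 else z $ k)"

lemma drop_coords_nth [simp]: "drop_coords J z $ k = (if k \<in> J then 0 else z $ k)"
  by (simp add: drop_coords_def)

lemma bounded_linear_drop_coords: "bounded_linear (drop_coords J)"
  unfolding linear_conv_bounded_linear[symmetric]
  by (rule linearI) (auto simp: vec_eq_iff)

lemma drop_coords_smult: "drop_coords J (c *s v) = c *s drop_coords J v"
  by (simp add: vec_eq_iff)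

text \<open>
  With \<open>P\<close> for \<open>drop_coords J\<close>, the hypothesis says that \<open>s\<close> acts outside \<open>J\<close> as translation by
  \<open>p\<close>. Therefore \<open>\<phi>\<close> subtracts a holomorphic function of the coordinates outside \<open>J\<close> from those in
  \<open>J\<close> and acts on the coordinates outside \<open>J\<close> as translation by \<open>-p\<close>. As \<open>P (\<phi> z) = P (z - p)\<close>,
  what was subtracted can be read off from \<open>\<phi> z\<close> and added back.
\<close>

lemma shear_biholomorphism:
  fixes s :: "complex^'m::finite \<Rightarrow> complex^'m"
  assumes "open U" "open V" "holomorphic_map s V"
    and translates: "\<And>y. y \<in> V \<Longrightarrow> drop_coords J (s y) = drop_coords J y + drop_coords J p"
  defines "\<phi> \<equiv> \<lambda>z. z - s (drop_coords J (z - p)) + drop_coords J (z - p)"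
    and "M \<equiv> {z \<in> U. drop_coords J (z - p) \<in> V}"
  shows "biholomorphism_on \<phi> M"
    and "\<And>z. z \<in> M \<Longrightarrow> drop_coords J (\<phi> z) = drop_coords J (z - p)"
    and "\<And>l. l \<in> \<phi> ` M \<Longrightarrow>
           inv_into M \<phi> l = l + s (drop_coords J l) - drop_coords J l"
proof -
  let ?P = "drop_coords J"
  define \<psi> where "\<psi> l = l + s (?P l) - ?P l" for l
  have idem: "?P (?P x) = ?P x" for x by (simp add: vec_eq_iff)
  have add: "?P (x + y) = ?P x + ?P y" "?P (x - y) = ?P x - ?P y" for x y
    by (simp_all add: vec_eq_iff)
  have translates': "?P (s (?P y)) = ?P y + ?P p" if "?P y \<in> V" for y
    using translates[OF that] by (simp add: idem)
  have P\<phi>: "?P (\<phi> z) = ?P (z - p)" if "?P (z - p) \<in> V" for z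
    using translates'[OF that] unfolding \<phi>_def add idem by (simp add: add)
  then show P\<phi>_M: "\<And>z. z \<in> M \<Longrightarrow> ?P (\<phi> z) = ?P (z - p)"
    unfolding M_def by blast
  have P\<psi>: "?P (\<psi> l - p) = ?P l" if "?P l \<in> V" for l
    using translates'[OF that] unfolding \<psi>_def add idem by simp
  have \<psi>\<phi>: "\<psi> (\<phi> z) = z" if "?P (z - p) \<in> V" for z
    using P\<phi>[OF that] unfolding \<psi>_def by (simp add: \<phi>_def)
  have \<phi>\<psi>: "\<phi> (\<psi> l) = l" if "?P l \<in> V" for l
    using P\<psi>[OF that] unfolding \<phi>_def by (simp add: \<psi>_def)
  have inj: "inj_on \<phi> M"
    using \<psi>\<phi> unfolding M_def by (metis (mono_tags, lifting) inj_onI mem_Collect_eq)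
  have image: "\<phi> ` M = {l. ?P l \<in> V} \<inter> \<psi> -` U"
  proof (intro equalityI subsetI)
    fix l assume "l \<in> \<phi> ` M"
    then show "l \<in> {l. ?P l \<in> V} \<inter> \<psi> -` U"
      using P\<phi> \<psi>\<phi> by (auto simp: M_def)
  next
    fix l assume "l \<in> {l. ?P l \<in> V} \<inter> \<psi> -` U"
    then have "\<psi> l \<in> M" "\<phi> (\<psi> l) = l" using P\<psi> \<phi>\<psi> by (auto simp: M_def)
    then show "l \<in> \<phi> ` M" by (metis image_eqI)
  qed
  show inv: "inv_into M \<phi> l = l + s (?P l) - ?P l" if "l \<in> \<phi> ` M" for l
  proof -
    have "\<psi> l \<in> M" "\<phi> (\<psi> l) = l"
      using that \<phi>\<psi>[of l] P\<psi>[of l] unfolding image by (auto simp: M_def)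
    then show ?thesis using inv_into_f_eq[OF inj] unfolding \<psi>_def by blast
  qed
  have holP: "holomorphic_map (\<lambda>z. ?P (z - a)) S" for a S
    by (rule holomorphic_map_linear_translate[OF bounded_linear_drop_coords drop_coords_smult])
  have hol_id: "holomorphic_map (\<lambda>z. z) S" for S :: "(complex^'m) set"
    using holomorphic_map_linear_translate[OF bounded_linear_ident, of 0 S] by simp
  have hol_uminus: "holomorphic_map uminus S" for S :: "(complex^'m) set"
    using holomorphic_map_linear_translate[OF bounded_linear_minus[OF bounded_linear_ident], of 0 S]
    by (simp add: vec_eq_iff)
  have hol_diff: "holomorphic_map (\<lambda>z. F z - G z) S"
    if "holomorphic_map F S" "holomorphic_map G S" for F G :: "complex^'m \<Rightarrow> complex^'m" and S
    using holomorphic_map_add[OF that(1) holomorphic_map_compose[OF that(2) hol_uminus[of UNIV]]] by simp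
  have hol\<phi>: "holomorphic_map \<phi> M"
    unfolding \<phi>_def
    by (intro holomorphic_map_add hol_diff hol_id holP holomorphic_map_compose[OF holP assms(3)])
       (simp add: M_def)
  have hol\<psi>: "holomorphic_map \<psi> {l. ?P l \<in> V}"
    unfolding \<psi>_def using holP[of 0]
    by (intro holomorphic_map_add hol_diff hol_id holomorphic_map_compose[OF _ assms(3)]) auto
  have contP: "continuous_on UNIV (\<lambda>z. ?P (z - a))" for a
    by (rule holomorphic_map_continuous_on[OF holP])
  have "open ({l. ?P l \<in> V})"
    using open_vimage[OF \<open>open V\<close> contP[of 0]] by (simp add: vimage_def)
  then have "open (\<phi> ` M)"
    unfolding image
    by (rule continuous_open_preimage[OF holomorphic_map_continuous_on[OF hol\<psi>] _ \<open>open U\<close>])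
  moreover have "open M"
    using open_Int[OF \<open>open U\<close> open_vimage[OF \<open>open V\<close> contP[of p]]]
    by (simp add: M_def vimage_def Int_def)
  moreover have "holomorphic_map (inv_into M \<phi>) (\<phi> ` M)"
  proof -
    have "holomorphic_map \<psi> (\<phi> ` M)"
      by (rule holomorphic_map_subset[OF hol\<psi>]) (auto simp: image)
    moreover have "inv_into M \<phi> l = \<psi> l" if "l \<in> \<phi> ` M" for l
      using inv[OF that] by (simp add: \<psi>_def)
    ultimately show ?thesis
      unfolding holomorphic_map_iff using \<open>open (\<phi> ` M)\<close>
      by (metis (no_types, lifting) has_derivative_transform_within_open)
  qed
  ultimately show "biholomorphism_on \<phi> M"
    unfolding biholomorphism_on_def using inj hol\<phi> by blast
qed

text \<open>
  The map \<open>G\<close> with components \<open>g\<^sub>1, \<dots>, g\<^sub>d\<close> in the first \<open>d\<close> coordinates and \<open>z\<^sub>k - p\<^sub>k\<close> in the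
  others has a block triangular Jacobian at \<open>p\<close>, which is injective as the block of the \<open>g\<^sub>i\<close> is
  invertible.
\<close>

lemma straighten_defining_functions:
  fixes p :: "complex^'m::finite" and d :: nat
  assumes \<sigma>: "coordinate_order \<sigma>" and d: "d \<le> CARD('m)"
    and "open W" "p \<in> W" and hol: "\<And>i. i \<in> {1..d} \<Longrightarrow> holomorphic_scv (g i) W"
    and invertible: "invertible_upto d (\<lambda>i j. partial_deriv (\<sigma> j) (g i) p)"
  obtains G H :: "complex^'m \<Rightarrow> complex^'m" and U V where
    "open U" "U \<subseteq> W" "p \<in> U" "open V" "G p \<in> V"
    "homeomorphism U V G H" "holomorphic_map H V"
    "\<And>i z. i \<in> {1..d} \<Longrightarrow> G z $ \<sigma> i = g i z"
    "\<And>z. drop_coords (\<sigma> ` {1..d}) (G z) = drop_coords (\<sigma> ` {1..d}) (z - p)"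
proof -
  let ?J = "\<sigma> ` {1..d}"
  have inj: "inj_on \<sigma> {1..d}"
    using \<sigma> d unfolding coordinate_order_def bij_betw_def
    by (meson atLeastatMost_subset_iff inj_on_subset order_refl)
  define G where "G z = (\<chi> k. if k \<in> ?J then g (the_inv_into {1..d} \<sigma> k) z else z $ k - p $ k)" for z
  have G1: "G z $ \<sigma> i = g i z" if "i \<in> {1..d}" for i z
    using that by (simp add: G_def the_inv_into_f_f[OF inj])
  have G2: "G z $ k = z $ k - p $ k" if "k \<notin> ?J" for k z
    using that by (simp add: G_def)
  have coord: "((\<lambda>z. z $ k - p $ k) has_derivative (\<lambda>v. v $ k)) (at z)" for k z
    by (auto intro!: derivative_eq_intros bounded_linear_imp_has_derivative bounded_linear_vec_nth)
  have "holomorphic_map G W"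
    unfolding holomorphic_map_def
  proof
    fix k
    show "holomorphic_scv (\<lambda>z. G z $ k) W"
    proof (cases "k \<in> ?J")
      case True
      then show ?thesis using hol by (auto simp: G1)
    next
      case False
      then show ?thesis
        using coord[of k] unfolding holomorphic_scv_iff by (auto simp: G2 intro!: exI[of _ "\<lambda>v. v $ k"])
    qed
  qed
  moreover have "v = 0" if v: "\<And>k. (\<Sum>j\<in>UNIV. v $ j * partial_deriv j (\<lambda>z. G z $ k) p) = 0" for v
  proof -
    have v_out: "v $ k = 0" if "k \<notin> ?J" for k
    proof -
      have "partial_deriv j (\<lambda>z. G z $ k) p = axis j 1 $ k" for j
        using partial_deriv_eq_derivative_axis[OF coord] G2[OF that] by simp
      then have "(\<Sum>j\<in>UNIV. v $ j * axis j 1 $ k) = 0"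
        using v[of k] by simp
      moreover have "(\<Sum>j\<in>UNIV. v $ j *s axis j 1) $ k = v $ k"
        by (simp add: basis_expansion)
      ultimately show ?thesis by (simp add: sum_component)
    qed
    obtain B where B: "\<And>i k. i \<in> {1..d} \<Longrightarrow> k \<in> {1..d} \<Longrightarrow>
        (\<Sum>j=1..d. B i j * partial_deriv (\<sigma> k) (g j) p) = (if i = k then 1 else 0)"
      using invertible unfolding invertible_upto_def by blast
    have row: "(\<Sum>k=1..d. v $ \<sigma> k * partial_deriv (\<sigma> k) (g j) p) = 0" if "j \<in> {1..d}" for j
    proof -
      have "(\<Sum>k\<in>?J. v $ k * partial_deriv k (g j) p) = (\<Sum>k\<in>UNIV. v $ k * partial_deriv k (g j) p)"
        by (rule sum.mono_neutral_left) (auto simp: v_out)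
      also have "\<dots> = 0" using v[of "\<sigma> j"] G1[OF that] by simp
      finally show ?thesis by (simp add: sum.reindex[OF inj])
    qed
    have "v $ \<sigma> i = 0" if i: "i \<in> {1..d}" for i
    proof -
      have "v $ \<sigma> i = (\<Sum>k=1..d. v $ \<sigma> k * (if i = k then 1 else 0))"
        using i by (simp add: if_distrib[of "\<lambda>x. _ * x"] sum.delta cong: if_cong)
      also have "\<dots> = (\<Sum>k=1..d. v $ \<sigma> k * (\<Sum>j=1..d. B i j * partial_deriv (\<sigma> k) (g j) p))"
        using B[OF i] by (intro sum.cong) auto
      also have "\<dots> = (\<Sum>j=1..d. B i j * (\<Sum>k=1..d. v $ \<sigma> k * partial_deriv (\<sigma> k) (g j) p))"
        unfolding sum_distrib_left by (subst sum.swap) (simp add: mult.left_commute)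
      also have "\<dots> = 0" using row by simp
      finally show ?thesis .
    qed
    with v_out show "v = 0" unfolding vec_eq_iff by (metis image_iff zero_index)
  qed
  ultimately obtain U V H where "open U" "U \<subseteq> W" "p \<in> U" "open V" "G p \<in> V"
    "homeomorphism U V G H" "holomorphic_map H V"
    using holomorphic_inverse_function_theorem[OF \<open>open W\<close> \<open>p \<in> W\<close>] by blast
  moreover have "drop_coords ?J (G z) = drop_coords ?J (z - p)" for z
    by (simp add: vec_eq_iff G2)
  ultimately show ?thesis using that G1 by blast
qed

text \<open>
  With \<open>P\<close> for the map that sets the first \<open>d\<close> coordinates to zero and \<open>H\<close> for the inverse of the
  straightening map \<open>G\<close>, the set \<open>Z\<close> is near \<open>p\<close> the set of fixed points of \<open>z \<mapsto> H (P (z - p))\<close>,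
  that is, a graph over the last coordinates. The shear along this graph is the chart, and
  \<open>H 0 = p\<close> makes its inverse a translation by \<open>p\<close> on the slice \<open>P \<lambda> = 0\<close>.
\<close>

lemma exists_shear_chart:
  fixes p :: "complex^'m::finite"
  assumes "adapted_order \<Omega> Z d p \<sigma>" "p \<in> Z"
  obtains U \<phi> where "admissible_chart \<Omega> Z d \<sigma> p U \<phi>"
    "\<And>l. l \<in> \<phi> ` U \<Longrightarrow> drop_coords (\<sigma> ` {1..d}) l = 0 \<Longrightarrow> inv_into U \<phi> l = l + p"
proof -
  let ?J = "\<sigma> ` {1..d}"
  let ?P = "drop_coords ?J"
  obtain W g where \<sigma>: "coordinate_order \<sigma>" and loc: "local_defining_functions \<Omega> Z d p W g"
    and inv: "invertible_upto d (\<lambda>i j. partial_deriv (\<sigma> j) (g i) p)"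
    using assms(1) unfolding adapted_order_def by blast
  from loc have W: "open W" "p \<in> W" "W \<subseteq> \<Omega>" and hol: "\<And>i. i \<in> {1..d} \<Longrightarrow> holomorphic_scv (g i) W"
    and Z: "Z \<inter> W = {z\<in>W. \<forall>i\<in>{1..d}. g i z = 0}"
    and dim: "vec.dim ((\<lambda>i. gradient (g i) p) ` {1..d}) = d"
    unfolding local_defining_functions_def by blast+
  have "d \<le> CARD('m)"
    using vec.dim_subset_UNIV[of "(\<lambda>i. gradient (g i) p) ` {1..d}"] unfolding dim vec.dimension_def card_cart_basis .
  then obtain G U V H where U: "open U" "U \<subseteq> W" "p \<in> U" and V: "open V" "G p \<in> V"
    and hom: "homeomorphism U V G H" and H: "holomorphic_map H V"
    and G: "\<And>i z. i \<in> {1..d} \<Longrightarrow> G z $ \<sigma> i = g i z" "\<And>z. ?P (G z) = ?P (z - p)"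
    using straighten_defining_functions[where g = g, OF \<sigma> _ W(1,2) hol inv] by metis
  have HG: "H (G z) = z" if "z \<in> U" for z using hom that unfolding homeomorphism_def by blast
  have GH: "G (H y) = y" "H y \<in> U" if "y \<in> V" for y using hom that unfolding homeomorphism_def by blast+
  have P_eq: "x = y \<longleftrightarrow> ?P x = ?P y \<and> (\<forall>k\<in>?J. x $ k = y $ k)" for x y
    unfolding vec_eq_iff drop_coords_nth by metis
  have zeros: "z \<in> Z \<longleftrightarrow> G z = ?P (z - p)" if "z \<in> U" for z
  proof -
    have "z \<in> Z \<longleftrightarrow> (\<forall>i\<in>{1..d}. G z $ \<sigma> i = 0)"
      using Z U(2) that G(1) by auto
    also have "\<dots> \<longleftrightarrow> G z = ?P (z - p)"
      unfolding P_eq[of "G z"] by (auto simp: G(2) vec_eq_iff)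
    finally show ?thesis .
  qed
  have "G p = 0" using zeros[OF U(3)] assms(2) by (simp add: vec_eq_iff)
  define \<phi> where "\<phi> = (\<lambda>z. z - H (?P (z - p)) + ?P (z - p))"
  define M where "M = {z \<in> U. ?P (z - p) \<in> V}"
  have slice: "?P (H y) = ?P y + ?P p" if "y \<in> V" for y
    using G(2)[of "H y"] GH[OF that] by (auto simp: vec_eq_iff)
  note shear = shear_biholomorphism[OF U(1) V(1) H slice, folded M_def]
  have biholo: "biholomorphism_on \<phi> M"
    unfolding \<phi>_def using shear(1) by simp
  have P\<phi>: "\<And>z. z \<in> M \<Longrightarrow> ?P (\<phi> z) = ?P (z - p)"
    unfolding \<phi>_def using shear(2) by simp
  have inverse: "\<And>l. l \<in> \<phi> ` M \<Longrightarrow> inv_into M \<phi> l = l + H (?P l) - ?P l"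
    unfolding \<phi>_def using shear(3) by simp
  have P0: "?P 0 = 0" by (simp add: vec_eq_iff)
  have H0: "H 0 = p" using HG[OF U(3)] \<open>G p = 0\<close> by simp
  have "p \<in> M" using U(3) V(2) by (simp add: M_def P0 \<open>G p = 0\<close>)
  have "\<phi> p = 0" by (simp add: \<phi>_def P0 H0)
  have in_Z: "z \<in> Z \<longleftrightarrow> (\<forall>i\<in>{1..d}. \<phi> z $ \<sigma> i = 0)" if "z \<in> M" for z
  proof -
    have z: "z \<in> U" "?P (z - p) \<in> V" using that by (auto simp: M_def)
    have "z \<in> Z \<longleftrightarrow> z = H (?P (z - p))"
      using zeros[OF z(1)] HG[OF z(1)] GH(1)[OF z(2)] by metis
    also have "\<dots> \<longleftrightarrow> \<phi> z = ?P (z - p)"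
      by (auto simp: \<phi>_def)
    also have "\<dots> \<longleftrightarrow> (\<forall>i\<in>{1..d}. \<phi> z $ \<sigma> i = 0)"
      unfolding P_eq[of "\<phi> z"] P\<phi>[OF that] by (auto simp: vec_eq_iff)
    finally show ?thesis .
  qed
  have "\<phi> z $ \<sigma> i = z $ \<sigma> i - p $ \<sigma> i" if "z \<in> M" "i \<in> {d+1..CARD('m)}" for z i
  proof -
    have "\<sigma> i \<notin> ?J"
    proof
      assume "\<sigma> i \<in> ?J"
      then obtain j where j: "j \<in> {1..d}" "\<sigma> i = \<sigma> j" by blast
      have "inj_on \<sigma> {1..CARD('m)}"
        using \<sigma> by (simp add: coordinate_order_def bij_betw_def)
      from inj_onD[OF this j(2)] j(1) that(2) show False by auto
    qed
    then show ?thesis using P\<phi>[OF that(1)] by (metis (mono_tags) drop_coords_nth vector_minus_component)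
  qed
  moreover have "\<phi> ` (M \<inter> Z) = {l \<in> \<phi> ` M. \<forall>i\<in>{1..d}. l $ \<sigma> i = 0}"
    using in_Z by blast
  moreover have "open M" using biholo by (simp add: biholomorphism_on_def)
  moreover have "M \<subseteq> \<Omega>" using U(2) W(3) by (auto simp: M_def)
  ultimately have "admissible_chart \<Omega> Z d \<sigma> p M \<phi>"
    unfolding admissible_chart_def using biholo \<open>p \<in> M\<close> \<open>\<phi> p = 0\<close> by blast
  moreover have "inv_into M \<phi> l = l + p" if "l \<in> \<phi> ` M" "?P l = 0" for l
    using inverse[OF that(1)] by (simp add: that(2) H0)
  ultimately show ?thesis using that by blast
qed

section \<open>Derivatives along a slice\<close>

text \<open>
  The difference quotients in a direction of \<open>J\<close> stay in the slice. The hypothesis and the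
  conclusion have the same form, so that the lemma can be iterated; this is why agreement on a
  relatively open part of the slice is propagated, and not merely a value at one point.
\<close>

lemma partial_deriv_eq_on_slice:
  assumes "open S" "k \<in> J"
    and eq: "\<And>z. z \<in> S \<Longrightarrow> drop_coords J z = 0 \<Longrightarrow> F z = F' (z + b)"
    and "z \<in> S" "drop_coords J z = 0"
  shows "partial_deriv k F z = partial_deriv k F' (z + b)"
  unfolding partial_deriv_def
proof (rule deriv_cong_ev)
  obtain e where e: "e > 0" "ball z e \<subseteq> S"
    using \<open>open S\<close> \<open>z \<in> S\<close> open_contains_ball by blast
  have "z + w *s axis k 1 \<in> S" if "dist w 0 < e" for w
    using that e(2) by (auto simp: subset_iff dist_norm norm_smult_axis)
  then have "\<forall>\<^sub>F w in nhds 0. z + w *s axis k 1 \<in> S"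
    using e(1) unfolding eventually_nhds_metric by blast
  then show "\<forall>\<^sub>F w in nhds 0. F (z + w *s axis k 1) = F' (z + b + w *s axis k 1)"
  proof eventually_elim
    case (elim w)
    have "drop_coords J (z + w *s axis k 1) = 0"
      using assms(2,5) by (simp add: vec_eq_iff axis_def) metis
    from eq[OF elim this] show ?case by (simp add: ac_simps)
  qed
qed simp

lemma multi_deriv_eq_on_slice:
  assumes "open S"
    and eq: "\<And>z. z \<in> S \<Longrightarrow> drop_coords (\<sigma> ` {1..d}) z = 0 \<Longrightarrow> F z = F' (z + b)"
    and "z \<in> S" "drop_coords (\<sigma> ` {1..d}) z = 0"
  shows "multi_deriv \<sigma> d \<alpha> F z = multi_deriv \<sigma> d \<alpha> F' (z + b)"
proof -
  let ?J = "\<sigma> ` {1..d}"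
  have iterate: "(partial_deriv k ^^ N) F1 z = (partial_deriv k ^^ N) F2 (z + b)"
    if "k \<in> ?J" "\<And>z. z \<in> S \<Longrightarrow> drop_coords ?J z = 0 \<Longrightarrow> F1 z = F2 (z + b)"
      "z \<in> S" "drop_coords ?J z = 0" for k N F1 F2 z
    using that(3,4)
  proof (induction N arbitrary: z)
    case 0
    then show ?case using that(2) by simp
  next
    case (Suc N)
    show ?case
      unfolding funpow.simps comp_def
      by (rule partial_deriv_eq_on_slice[where J = ?J]) (fact \<open>open S\<close> that(1) Suc.IH Suc.prems)+
  qed
  have "foldr (\<lambda>i. partial_deriv (\<sigma> i) ^^ \<alpha> i) is F z = foldr (\<lambda>i. partial_deriv (\<sigma> i) ^^ \<alpha> i) is F' (z + b)"
    if "set is \<subseteq> {1..d}" "z \<in> S" "drop_coords ?J z = 0" for "is" z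
    using that
  proof (induction "is" arbitrary: z)
    case Nil
    then show ?case using eq by simp
  next
    case (Cons i "is")
    show ?case using Cons.prems unfolding foldr.simps comp_def
      by (intro iterate) (auto intro: Cons.IH)
  qed
  from this[of "[1..<Suc d]" z] assms(3,4) show ?thesis
    unfolding multi_deriv_def by (simp add: atLeastLessThanSuc_atLeastAtMost del: upt_Suc)
qed

section \<open>Comparison of the derivatives\<close>

theorem proposition3p10:
  fixes \<Omega> Z :: "(complex^'m::finite) set" and f :: "complex^'m \<Rightarrow> complex"
    and d n :: nat and p :: "complex^'m"
  assumes "open \<Omega>" and "connected \<Omega>" and "bounded \<Omega>"
    and "complex_submanifold \<Omega> Z d"
    and "holomorphic_scv f \<Omega>"
    and "p \<in> Z" and "n \<ge> 1"
  shows "(\<exists>\<sigma>. adapted_order \<Omega> Z d p \<sigma>) \<and>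
    (\<forall>\<sigma>. adapted_order \<Omega> Z d p \<sigma> \<longrightarrow>
      (\<exists>U \<phi>. admissible_chart \<Omega> Z d \<sigma> p U \<phi> \<and>
        ((\<forall>\<alpha>. (\<Sum>i=1..d. \<alpha> i) \<le> n \<longrightarrow> multi_deriv \<sigma> d \<alpha> (f \<circ> inv_into U \<phi>) (\<phi> p) = 0) \<longleftrightarrow>
         (\<forall>\<alpha>. (\<Sum>i=1..d. \<alpha> i) \<le> n \<longrightarrow> multi_deriv \<sigma> d \<alpha> f p = 0))))"
proof (intro conjI allI impI)
  show "\<exists>\<sigma>. adapted_order \<Omega> Z d p \<sigma>"
    using assms(4,6) exists_adapted_order unfolding complex_submanifold_def by blast
next
  fix \<sigma> assume "adapted_order \<Omega> Z d p \<sigma>"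
  then obtain U \<phi> where chart: "admissible_chart \<Omega> Z d \<sigma> p U \<phi>"
    and inverse: "\<And>l. l \<in> \<phi> ` U \<Longrightarrow> drop_coords (\<sigma> ` {1..d}) l = 0 \<Longrightarrow> inv_into U \<phi> l = l + p"
    using exists_shear_chart[OF _ \<open>p \<in> Z\<close>] by blast
  have \<phi>p: "\<phi> p = 0" and "open (\<phi> ` U)" and "0 \<in> \<phi> ` U"
    using chart unfolding admissible_chart_def biholomorphism_on_def by (auto intro: image_eqI[of _ _ p])
  have "multi_deriv \<sigma> d \<alpha> (f \<circ> inv_into U \<phi>) (\<phi> p) = multi_deriv \<sigma> d \<alpha> f p" for \<alpha>
    using multi_deriv_eq_on_slice[OF \<open>open (\<phi> ` U)\<close>, of \<sigma> d "f \<circ> inv_into U \<phi>" f p 0 \<alpha>]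
      inverse \<open>0 \<in> \<phi> ` U\<close>
    by (simp add: \<phi>p vec_eq_iff)
  with chart show "\<exists>U \<phi>. admissible_chart \<Omega> Z d \<sigma> p U \<phi> \<and>
        ((\<forall>\<alpha>. (\<Sum>i=1..d. \<alpha> i) \<le> n \<longrightarrow> multi_deriv \<sigma> d \<alpha> (f \<circ> inv_into U \<phi>) (\<phi> p) = 0) \<longleftrightarrow>
         (\<forall>\<alpha>. (\<Sum>i=1..d. \<alpha> i) \<le> n \<longrightarrow> multi_deriv \<sigma> d \<alpha> f p = 0))"
    by (intro exI[of _ U] exI[of _ \<phi>]) simp
qed

end
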